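(* Let $R$ be a commutative ring with identity and suppose that $(G,\alpha)$ is an edge-labeled graph on $n$ vertices. Fix a spanning tree $T$ for $G$. For each edge $e\in E(G)-E(T)$ let $C_e'$ denote the graph consisting of the unique cycle contained in $T\cup\{e\}$ together with the other vertices of $G$ (as isolated vertices). Then $$R_G=R_T\cap\bigcap_{e\in E(G)-E(T)}R_{C_e'}.$$
   Context: All graphs are finite, with no multiple edges, and edges join distinct vertices. An edge-labeling function on a graph $G=(V,E)$ is a map $\alpha$ from $E$ to the nonzero ideals of $R$. The ring of generalized splines is $R_G=R_{G,\alpha}=\{\mathbf{p}\in\bigoplus_{v\in V}R : \mathbf{p}_u-\mathbf{p}_v\in\alpha(uv)\text{ for every edge }uv\in E\}$. The spanning subgraphs $T$ and $C_e'$ of $G$ carry the restrictions of $\alpha$, so all rings in the formula are subrings of $\bigoplus_{v\in V(G)}R$. *)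

theory Defs
  imports "HOL-Algebra.Ideal" "HOL-Algebra.Subrings" "HOL-Library.FuncSet"
begin

section \<open>Finite simple graphs\<close>

text \<open>
  Undirected edges are two-element sets of vertices, which rules out loops and multiple edges.
  The symmetric digraphs of \<open>Graph_Theory\<close> are not used, because there a pair of opposite arcs
  already counts as a cycle, so that no graph with an edge would be a tree.
\<close>

record 'v sgraph =
  sverts :: "'v set"
  sedges :: "'v set set"

definition simple_graph :: "'v sgraph \<Rightarrow> bool" where
  "simple_graph G \<longleftrightarrow>
     finite (sverts G) \<and> (\<forall>e\<in>sedges G. e \<subseteq> sverts G \<and> card e = 2)"

definition subgraph_of :: "'v sgraph \<Rightarrow> 'v sgraph \<Rightarrow> bool" where
  "subgraph_of H G \<longleftrightarrow>
     simple_graph H \<and> sverts H \<subseteq> sverts G \<and> sedges H \<subseteq> sedges G"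

definition adj_rel :: "'v sgraph \<Rightarrow> 'v rel" where
  "adj_rel G = {(u, v). {u, v} \<in> sedges G}"

definition connected_graph :: "'v sgraph \<Rightarrow> bool" where
  "connected_graph G \<longleftrightarrow> (\<forall>u\<in>sverts G. \<forall>v\<in>sverts G. (u, v) \<in> (adj_rel G)\<^sup>*)"

text \<open>A cycle is a graph with vertices \<open>xs ! 0, \<dots>, xs ! (k - 1)\<close>, \<open>k \<ge> 3\<close>, joined cyclically.\<close>

definition cycle_graph :: "'v sgraph \<Rightarrow> bool" where
  "cycle_graph C \<longleftrightarrow>
     (\<exists>xs. length xs \<ge> 3 \<and> distinct xs \<and> sverts C = set xs \<and>
        sedges C = {{xs ! i, xs ! (Suc i mod length xs)} | i. i < length xs})"

definition tree_graph :: "'v sgraph \<Rightarrow> bool" where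
  "tree_graph T \<longleftrightarrow> simple_graph T \<and> connected_graph T \<and>
     (\<nexists>C. subgraph_of C T \<and> cycle_graph C)"

definition spanning_tree_of :: "'v sgraph \<Rightarrow> 'v sgraph \<Rightarrow> bool" where
  "spanning_tree_of T G \<longleftrightarrow> subgraph_of T G \<and> sverts T = sverts G \<and> tree_graph T"

definition add_edge :: "'v sgraph \<Rightarrow> 'v set \<Rightarrow> 'v sgraph" where
  "add_edge T e = \<lparr>sverts = sverts T, sedges = insert e (sedges T)\<rparr>"

definition fundamental_cycle :: "'v sgraph \<Rightarrow> 'v set \<Rightarrow> 'v sgraph" where
  "fundamental_cycle T e = (THE C. cycle_graph C \<and> subgraph_of C (add_edge T e))"

text \<open>The fundamental cycle, with all remaining vertices of the graph added as isolated vertices.\<close>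

definition spanning_cycle :: "'v sgraph \<Rightarrow> 'v sgraph \<Rightarrow> 'v set \<Rightarrow> 'v sgraph" where
  "spanning_cycle G T e =
     \<lparr>sverts = sverts G, sedges = sedges (fundamental_cycle T e)\<rparr>"

section \<open>Generalized splines\<close>

definition edge_labeling ::
  "('a, 'b) ring_scheme \<Rightarrow> 'v sgraph \<Rightarrow> ('v set \<Rightarrow> 'a set) \<Rightarrow> bool" where
  "edge_labeling R G \<alpha> \<longleftrightarrow> (\<forall>e\<in>sedges G. ideal (\<alpha> e) R \<and> \<alpha> e \<noteq> {\<zero>\<^bsub>R\<^esub>})"

text \<open>The direct sum of copies of \<open>R\<close> indexed by the finite set \<open>V\<close>, with pointwise operations.\<close>

definition power_ring :: "('a, 'b) ring_scheme \<Rightarrow> 'v set \<Rightarrow> ('v \<Rightarrow> 'a) ring" where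
  "power_ring R V =
     \<lparr>carrier = V \<rightarrow>\<^sub>E carrier R,
      mult = (\<lambda>p q. \<lambda>v\<in>V. p v \<otimes>\<^bsub>R\<^esub> q v),
      one = (\<lambda>v\<in>V. \<one>\<^bsub>R\<^esub>),
      zero = (\<lambda>v\<in>V. \<zero>\<^bsub>R\<^esub>),
      add = (\<lambda>p q. \<lambda>v\<in>V. p v \<oplus>\<^bsub>R\<^esub> q v)\<rparr>"

text \<open>
  As usual in \<open>HOL-Algebra\<close>, a subring of \<open>power_ring R (sverts G)\<close> is given by its carrier.
  Only the values of \<open>\<alpha>\<close> on the edges of \<open>G\<close> matter, so that a spanning subgraph is labeled by the
  restriction of \<open>\<alpha>\<close> when the same \<open>\<alpha>\<close> is passed.
\<close>

definition splines ::
  "('a, 'b) ring_scheme \<Rightarrow> 'v sgraph \<Rightarrow> ('v set \<Rightarrow> 'a set) \<Rightarrow> ('v \<Rightarrow> 'a) set" where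
  "splines R G \<alpha> =
     {p \<in> carrier (power_ring R (sverts G)).
        \<forall>u v. {u, v} \<in> sedges G \<longrightarrow> p u \<ominus>\<^bsub>R\<^esub> p v \<in> \<alpha> {u, v}}"

lemma power_ring_cring:
  assumes "cring R"
  shows "cring (power_ring R V)"
proof -
  interpret cring R by fact
  show ?thesis
  proof (rule cringI)
    show "abelian_group (power_ring R V)"
    proof (rule abelian_groupI)
      fix p assume p: "p \<in> carrier (power_ring R V)"
      show "\<exists>q\<in>carrier (power_ring R V). q \<oplus>\<^bsub>power_ring R V\<^esub> p = \<zero>\<^bsub>power_ring R V\<^esub>"
        using p by (intro bexI[of _ "\<lambda>v\<in>V. \<ominus>\<^bsub>R\<^esub> p v"])
          (auto simp: power_ring_def PiE_iff l_neg intro!: restrict_ext)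
    qed (auto simp: power_ring_def PiE_iff a_ac intro!: extensionalityI[of _ V])
    show "Group.comm_monoid (power_ring R V)"
      by (rule comm_monoidI)
         (auto simp: power_ring_def PiE_iff m_ac intro!: extensionalityI[of _ V])
  qed (auto simp: power_ring_def PiE_iff l_distr intro!: restrict_ext)
qed

lemma power_ring_a_inv:
  assumes "cring R" and p: "p \<in> carrier (power_ring R V)"
  shows "\<ominus>\<^bsub>power_ring R V\<^esub> p = (\<lambda>v\<in>V. \<ominus>\<^bsub>R\<^esub> p v)"
proof -
  interpret R: cring R by fact
  interpret P: cring "power_ring R V" by (rule power_ring_cring) fact
  show ?thesis
    by (rule P.minus_equality)
       (use p in \<open>auto simp: power_ring_def PiE_iff R.l_neg intro!: restrict_ext\<close>)
qed

lemma splines_subcring: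
  assumes R: "cring R" and G: "simple_graph G" and \<alpha>: "edge_labeling R G \<alpha>"
  shows "subcring (splines R G \<alpha>) (power_ring R (sverts G))"
proof -
  interpret R: cring R by fact
  interpret P: cring "power_ring R (sverts G)" by (rule power_ring_cring) fact
  have V: "u \<in> sverts G \<and> v \<in> sverts G" if "{u, v} \<in> sedges G" for u v
    using G that by (auto simp: simple_graph_def)
  have I: "ideal (\<alpha> {u, v}) R" if "{u, v} \<in> sedges G" for u v
    using \<alpha> that by (auto simp: edge_labeling_def)
  have p_in: "p u \<in> carrier R" if "p \<in> splines R G \<alpha>" "u \<in> sverts G" for p u
    using that by (auto simp: splines_def power_ring_def)
  have "subring (splines R G \<alpha>) (power_ring R (sverts G))"
  proof (rule P.subringI)
    show "splines R G \<alpha> \<subseteq> carrier (power_ring R (sverts G))"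
      by (auto simp: splines_def)
    show "\<one>\<^bsub>power_ring R (sverts G)\<^esub> \<in> splines R G \<alpha>"
      using V I by (auto simp: splines_def power_ring_def R.minus_eq R.r_neg
        additive_subgroup.zero_closed ideal.axioms(1))
  next
    fix p assume p: "p \<in> splines R G \<alpha>"
    then have pc: "p \<in> carrier (power_ring R (sverts G))" by (simp add: splines_def)
    have "\<ominus>\<^bsub>R\<^esub> p u \<ominus>\<^bsub>R\<^esub> (\<ominus>\<^bsub>R\<^esub> p v) \<in> \<alpha> {u, v}" if e: "{u, v} \<in> sedges G" for u v
    proof -
      interpret ideal "\<alpha> {u, v}" R by (rule I) fact
      have "\<ominus>\<^bsub>R\<^esub> p u \<ominus>\<^bsub>R\<^esub> (\<ominus>\<^bsub>R\<^esub> p v) = \<ominus>\<^bsub>R\<^esub> (p u \<ominus>\<^bsub>R\<^esub> p v)"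
        using V[OF e] p_in[OF p] by (simp add: R.minus_eq R.minus_add)
      then show ?thesis using p e by (simp add: splines_def)
    qed
    then show "\<ominus>\<^bsub>power_ring R (sverts G)\<^esub> p \<in> splines R G \<alpha>"
      unfolding power_ring_a_inv[OF R pc]
      using V p_in[OF p] by (auto simp: splines_def power_ring_def)
  next
    fix p q assume p: "p \<in> splines R G \<alpha>" and q: "q \<in> splines R G \<alpha>"
    have "(p u \<otimes>\<^bsub>R\<^esub> q u) \<ominus>\<^bsub>R\<^esub> (p v \<otimes>\<^bsub>R\<^esub> q v) \<in> \<alpha> {u, v}
        \<and> (p u \<oplus>\<^bsub>R\<^esub> q u) \<ominus>\<^bsub>R\<^esub> (p v \<oplus>\<^bsub>R\<^esub> q v) \<in> \<alpha> {u, v}"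
      if e: "{u, v} \<in> sedges G" for u v
    proof -
      interpret ideal "\<alpha> {u, v}" R by (rule I) fact
      note [simp] = V[OF e] p_in[OF p] p_in[OF q]
      have d: "p u \<ominus>\<^bsub>R\<^esub> p v \<in> \<alpha> {u, v}" "q u \<ominus>\<^bsub>R\<^esub> q v \<in> \<alpha> {u, v}"
        using p q e by (auto simp: splines_def)
      have "(p u \<otimes>\<^bsub>R\<^esub> q u) \<ominus>\<^bsub>R\<^esub> (p v \<otimes>\<^bsub>R\<^esub> q v)
          = p u \<otimes>\<^bsub>R\<^esub> (q u \<ominus>\<^bsub>R\<^esub> q v) \<oplus>\<^bsub>R\<^esub> (p u \<ominus>\<^bsub>R\<^esub> p v) \<otimes>\<^bsub>R\<^esub> q v"
        using V[OF e] p_in[OF p] p_in[OF q] by algebra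
      moreover have "(p u \<oplus>\<^bsub>R\<^esub> q u) \<ominus>\<^bsub>R\<^esub> (p v \<oplus>\<^bsub>R\<^esub> q v)
          = (p u \<ominus>\<^bsub>R\<^esub> p v) \<oplus>\<^bsub>R\<^esub> (q u \<ominus>\<^bsub>R\<^esub> q v)"
        using V[OF e] p_in[OF p] p_in[OF q] by algebra
      ultimately show ?thesis
        using d by (simp add: I_l_closed I_r_closed)
    qed
    then show "p \<otimes>\<^bsub>power_ring R (sverts G)\<^esub> q \<in> splines R G \<alpha>"
      and "p \<oplus>\<^bsub>power_ring R (sverts G)\<^esub> q \<in> splines R G \<alpha>"
      using V p_in[OF p] p_in[OF q] by (auto simp: splines_def power_ring_def)
  qed
  then show ?thesis
    by (rule P.subcringI')
qed

end

theory Submission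
  imports Defs
begin

text \<open>
  Every edge \<open>e\<close> of \<open>G\<close> outside \<open>T\<close> lies on its own fundamental cycle, so the edges of \<open>T\<close> and of the
  fundamental cycles together are exactly the edges of \<open>G\<close>, and a spline condition is a condition
  on single edges.  For the uniqueness of the cycle, an edge lies on a cycle of a graph iff its ends
  stay connected after its removal.  If \<open>C\<close> and \<open>D\<close> are cycles of \<open>T + e\<close> and \<open>f\<close> is an edge of \<open>C\<close>
  but not of \<open>D\<close>, then \<open>C - f\<close> joins the ends of \<open>f\<close>; replacing \<open>e\<close> by the path \<open>D - e\<close> shows that
  \<open>T - f\<close> joins them as well, so that \<open>f\<close> lies on a cycle of \<open>T\<close>.
\<close>

section \<open>Edges on cycles and connectedness after their removal\<close>

definition del_edge :: "'v sgraph \<Rightarrow> 'v set \<Rightarrow> 'v sgraph" where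
  "del_edge G e = \<lparr>sverts = sverts G, sedges = sedges G - {e}\<rparr>"

lemma adj_rel_rtrancl_sym: "(u, v) \<in> (adj_rel G)\<^sup>* \<Longrightarrow> (v, u) \<in> (adj_rel G)\<^sup>*"
  by (rule symD[OF sym_rtrancl]) (auto simp: sym_def adj_rel_def insert_commute)

text \<open>Induction along the walk: a new vertex is appended to the path, and if it already lies
  on the path, the path is cut back to it.\<close>

lemma rtrancl_imp_distinct_path:
  assumes "(a, b) \<in> r\<^sup>*"
  obtains xs where "xs \<noteq> []" "hd xs = a" "last xs = b" "distinct xs"
    "successively (\<lambda>x y. (x, y) \<in> r) xs"
proof -
  from assms have "\<exists>xs. xs \<noteq> [] \<and> hd xs = a \<and> last xs = b \<and> distinct xs \<and>
      successively (\<lambda>x y. (x, y) \<in> r) xs"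
  proof (induction rule: rtrancl_induct)
    case base
    show ?case by (intro exI[of _ "[a]"]) simp
  next
    case (step y z)
    then obtain xs where xs: "xs \<noteq> []" "hd xs = a" "last xs = y" "distinct xs"
      "successively (\<lambda>x y. (x, y) \<in> r) xs"
      by blast
    show ?case
    proof (cases "z \<in> set xs")
      case True
      then obtain as bs where "xs = as @ z # bs"
        by (meson split_list)
      with xs show ?thesis
        by (intro exI[of _ "as @ [z]"]) (auto simp: successively_append_iff hd_append)
    next
      case False
      with xs step.hyps show ?thesis
        by (intro exI[of _ "xs @ [z]"]) (auto simp: successively_append_iff)
    qed
  qed
  then show thesis
    using that by blast
qed

text \<open>A path from \<open>a\<close> to \<open>b\<close> without repeated vertices that avoids
  the edge \<open>{a, b}\<close> is closed up by that edge.\<close>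

lemma cycle_through_edge:
  assumes H: "simple_graph H" and e: "{a, b} \<in> sedges H"
    and conn: "(a, b) \<in> (adj_rel (del_edge H {a, b}))\<^sup>*"
  obtains C where "cycle_graph C" "subgraph_of C H" "{a, b} \<in> sedges C"
proof -
  obtain xs where xs: "xs \<noteq> []" "hd xs = a" "last xs = b" "distinct xs"
    and path: "successively (\<lambda>x y. (x, y) \<in> adj_rel (del_edge H {a, b})) xs"
    using rtrancl_imp_distinct_path[OF conn] .
  have "a \<noteq> b"
    using H e by (auto simp: simple_graph_def)
  \<comment> \<open>One vertex would mean \<open>a = b\<close>; with two, the path would be the
    deleted edge itself.\<close>
  have len: "length xs \<ge> 3"
  proof (rule ccontr)
    assume "\<not> length xs \<ge> 3"
    then consider x where "xs = [x]" | x y where "xs = [x, y]"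
      using xs(1) by (auto simp: not_le numeral_3_eq_3 less_Suc_eq length_Suc_conv)
    then show False
      using xs path \<open>a \<noteq> b\<close> by cases (auto simp: adj_rel_def del_edge_def)
  qed
  define edge where "edge i = {xs ! i, xs ! (Suc i mod length xs)}" for i
  define C where "C = \<lparr>sverts = set xs, sedges = {edge i | i. i < length xs}\<rparr>"
  \<comment> \<open>The index that wraps around modulo the length gives the closing edge; all others
    give steps of the path.\<close>
  have last_edge: "edge (length xs - 1) = {a, b}"
    using xs len by (auto simp: edge_def hd_conv_nth last_conv_nth)
  have edge_H: "edge i \<in> sedges H" if "i < length xs" for i
  proof (cases "Suc i < length xs")
    case True
    then show ?thesis
      using path by (auto simp: successively_conv_nth adj_rel_def del_edge_def edge_def)
  next
    case False
    with that have "i = length xs - 1" by simp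
    with last_edge e show ?thesis by simp
  qed
  have "cycle_graph C"
    unfolding cycle_graph_def using len xs(4)
    by (intro exI[of _ xs]) (simp add: C_def edge_def)
  moreover have "subgraph_of C H"
  proof -
    have "edge i \<subseteq> set xs" if "i < length xs" for i
    proof -
      have "Suc i mod length xs < length xs" using xs(1) by simp
      with that show ?thesis by (auto simp: edge_def)
    qed
    \<comment> \<open>\<open>adj_rel\<close> looks at edges only, so a vertex of the path is placed
      in \<open>H\<close> through an edge containing it.\<close>
    moreover have "x \<in> sverts H" if x: "x \<in> set xs" for x
    proof -
      obtain i where "i < length xs" "x = xs ! i"
        using x by (auto simp: in_set_conv_nth)
      then have "x \<in> edge i" "edge i \<in> sedges H"
        using edge_H by (auto simp: edge_def)
      then show ?thesis
        using H by (auto simp: simple_graph_def)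
    qed
    ultimately show ?thesis
      using H edge_H unfolding subgraph_of_def simple_graph_def C_def by auto
  qed
  moreover have "{a, b} \<in> sedges C"
  proof -
    have "length xs - 1 < length xs"
      using xs(1) by simp
    with last_edge show ?thesis
      unfolding C_def by fastforce
  qed
  ultimately show thesis
    using that by blast
qed

text \<open>Otherwise each of \<open>i\<close> and \<open>j\<close> would be the cyclic successor of
  the other, which a length of at least 3 excludes.\<close>

lemma cycle_edge_inj:
  assumes "distinct xs" "length xs \<ge> 3" "i < length xs" "j < length xs"
    and eq: "{xs ! i, xs ! (Suc i mod length xs)} = {xs ! j, xs ! (Suc j mod length xs)}"
  shows "i = j"
proof -
  have "Suc i mod length xs < length xs" "Suc j mod length xs < length xs"
    using assms by (auto intro!: mod_less_divisor)
  then have "i = j \<or> i = Suc j mod length xs \<and> j = Suc i mod length xs"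
    using assms by (auto simp: doubleton_eq_iff nth_eq_iff_index_eq)
  then show ?thesis
    using assms by (auto simp: mod_Suc split: if_splits)
qed

text \<open>The way round the rest of the cycle joins the two ends: it starts at the successor of
  position \<open>i\<close> and reaches \<open>i\<close> after \<open>k - 1\<close> steps.\<close>

lemma cycle_del_edge_connected:
  assumes C: "cycle_graph C" and e: "{a, b} \<in> sedges C"
  shows "(a, b) \<in> (adj_rel (del_edge C {a, b}))\<^sup>*"
proof -
  obtain xs where len: "length xs \<ge> 3" and dist: "distinct xs"
    and sE: "sedges C = {{xs ! i, xs ! (Suc i mod length xs)} | i. i < length xs}"
    using C unfolding cycle_graph_def by blast
  define k where "k = length xs"
  obtain i where i: "i < k" and ab: "{a, b} = {xs ! i, xs ! (Suc i mod k)}"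
    using e sE unfolding k_def by blast
  define r where "r = adj_rel (del_edge C {a, b})"
  have walk: "(xs ! (Suc i mod k), xs ! ((Suc i + j) mod k)) \<in> r\<^sup>*" if "j < k" for j
    using that
  proof (induction j)
    case 0
    then show ?case by simp
  next
    case (Suc j)
    define m where "m = (Suc i + j) mod k"
    have "m < k" using Suc.prems by (simp add: m_def)
    \<comment> \<open>The walk has not yet come back to \<open>i\<close>: that would make
      \<open>k\<close> divide \<open>Suc j\<close>, while \<open>0 < Suc j < k\<close>. Hence its
      next edge is not the deleted one.\<close>
    have "m \<noteq> i"
    proof
      assume "m = i"
      then have "(i + Suc j) mod k = i mod k"
        using i by (simp add: m_def)
      then have "k dvd Suc j"
        by (metis add_diff_cancel_left' le_add1 mod_eq_dvd_iff_nat)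
      with Suc.prems show False by (auto dest: dvd_imp_le)
    qed
    then have "{xs ! m, xs ! (Suc m mod k)} \<noteq> {a, b}"
      using cycle_edge_inj[OF dist len, of m i] \<open>m < k\<close> i ab by (auto simp: k_def)
    then have "(xs ! m, xs ! (Suc m mod k)) \<in> r"
      using \<open>m < k\<close> unfolding r_def adj_rel_def del_edge_def sE k_def by auto
    moreover have "Suc m mod k = (Suc i + Suc j) mod k"
      by (simp add: m_def mod_Suc_eq)
    ultimately show ?case
      using Suc by (auto simp: m_def intro: rtrancl_into_rtrancl)
  qed
  have "(Suc i + (k - 1)) mod k = i"
    using i by simp
  with walk[of "k - 1"] i have "(xs ! (Suc i mod k), xs ! i) \<in> r\<^sup>*"
    by simp
  moreover from this have "(xs ! i, xs ! (Suc i mod k)) \<in> r\<^sup>*"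
    unfolding r_def by (rule adj_rel_rtrancl_sym)
  ultimately show ?thesis
    using ab unfolding r_def[symmetric] by (auto simp: doubleton_eq_iff)
qed

text \<open>Serves to recover a cycle from its edges alone, so that uniqueness need only be shown
  for edge sets.\<close>

lemma cycle_verts:
  assumes "cycle_graph C" "simple_graph C"
  shows "sverts C = \<Union> (sedges C)"
proof
  show "sverts C \<subseteq> \<Union> (sedges C)"
  proof
    fix v assume "v \<in> sverts C"
    moreover obtain xs where "sverts C = set xs"
      and sE: "sedges C = {{xs ! i, xs ! (Suc i mod length xs)} | i. i < length xs}"
      using assms(1) unfolding cycle_graph_def by blast
    ultimately obtain i where "i < length xs" "v = xs ! i"
      by (metis in_set_conv_nth)
    then have "v \<in> {xs ! i, xs ! (Suc i mod length xs)}"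
      and "{xs ! i, xs ! (Suc i mod length xs)} \<in> sedges C"
      unfolding sE by auto
    then show "v \<in> \<Union> (sedges C)"
      by blast
  qed
  show "\<Union> (sedges C) \<subseteq> sverts C"
    using assms(2) by (auto simp: simple_graph_def)
qed

section \<open>Cycles in a tree with one added edge\<close>

lemma simple_graph_add_edge:
  "simple_graph T \<Longrightarrow> e \<subseteq> sverts T \<Longrightarrow> card e = 2 \<Longrightarrow> simple_graph (add_edge T e)"
  by (auto simp: simple_graph_def add_edge_def)

text \<open>A cycle avoiding \<open>e\<close> would already lie in the tree.\<close>

lemma tree_add_edge_cycle_contains:
  assumes T: "tree_graph T" and C: "cycle_graph C" "subgraph_of C (add_edge T e)"
  shows "e \<in> sedges C"
proof (rule ccontr)
  assume "e \<notin> sedges C"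
  with C have "subgraph_of C T"
    by (auto simp: subgraph_of_def add_edge_def)
  with T C show False
    by (auto simp: tree_graph_def)
qed

text \<open>The hypotheses are symmetric in \<open>C\<close> and \<open>D\<close>, so one inclusion
  yields equality of the edge sets.\<close>

lemma tree_add_edge_cycle_edges_subset:
  assumes T: "tree_graph T"
    and C: "cycle_graph C" "subgraph_of C (add_edge T e)"
    and D: "cycle_graph D" "subgraph_of D (add_edge T e)"
  shows "sedges C \<subseteq> sedges D"
proof
  fix f assume f: "f \<in> sedges C"
  show "f \<in> sedges D"
  proof (rule ccontr)
    assume fD: "f \<notin> sedges D"
    have eD: "e \<in> sedges D"
      by (rule tree_add_edge_cycle_contains[OF T D])
    with fD have "f \<noteq> e" by blast
    with f C have fT: "f \<in> sedges T"
      by (auto simp: subgraph_of_def add_edge_def)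
    have sT: "simple_graph T"
      using T by (simp add: tree_graph_def)
    with fT obtain a b where ab: "f = {a, b}"
      by (metis card_2_iff simple_graph_def)
    have "adj_rel (del_edge C f) \<subseteq> (adj_rel (del_edge T f))\<^sup>*"
    proof clarify
      fix u v assume "(u, v) \<in> adj_rel (del_edge C f)"
      then have uv: "{u, v} \<in> sedges C" "{u, v} \<noteq> f"
        by (auto simp: adj_rel_def del_edge_def)
      show "(u, v) \<in> (adj_rel (del_edge T f))\<^sup>*"
      proof (cases "{u, v} = e")
        case True
        \<comment> \<open>Apart from \<open>e\<close>, all edges of \<open>D\<close> are tree edges,
          and none is \<open>f\<close>; thus the detour along \<open>D\<close> stays in
          \<open>T\<close> without \<open>f\<close>.\<close>
        have "adj_rel (del_edge D e) \<subseteq> adj_rel (del_edge T f)"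
          using D fD by (auto simp: adj_rel_def del_edge_def subgraph_of_def add_edge_def)
        from rtrancl_mono[OF this] show ?thesis
          using cycle_del_edge_connected[OF D(1), of u v] True eD by blast
      next
        case False
        with uv C show ?thesis
          by (auto simp: adj_rel_def del_edge_def subgraph_of_def add_edge_def)
      qed
    qed
    from rtrancl_subset_rtrancl[OF this] have "(a, b) \<in> (adj_rel (del_edge T {a, b}))\<^sup>*"
      using cycle_del_edge_connected[OF C(1), of a b] f ab by blast
    then show False
      using cycle_through_edge[OF sT, of a b] fT ab T by (auto simp: tree_graph_def)
  qed
qed

text \<open>Justifies the definite description: connectedness of \<open>T\<close> gives a cycle
  through \<open>e\<close>, and the preceding inclusion makes it the only one.\<close>

lemma fundamental_cycle:
  assumes T: "tree_graph T" and e: "e \<subseteq> sverts T" "card e = 2" "e \<notin> sedges T"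
  shows "cycle_graph (fundamental_cycle T e)"
    and "subgraph_of (fundamental_cycle T e) (add_edge T e)"
proof -
  obtain a b where ab: "e = {a, b}"
    using e(2) by (meson card_2_iff)
  have sT: "simple_graph T"
    using T by (simp add: tree_graph_def)
  have "del_edge (add_edge T e) e = T"
    using e(3) by (simp add: del_edge_def add_edge_def)
  moreover have "(a, b) \<in> (adj_rel T)\<^sup>*"
    using T e(1) ab by (auto simp: tree_graph_def connected_graph_def)
  ultimately obtain C where C: "cycle_graph C" "subgraph_of C (add_edge T e)"
    using cycle_through_edge[OF simple_graph_add_edge[OF sT e(1,2)], of a b] ab
    by (auto simp: add_edge_def)
  have "D = C" if D: "cycle_graph D" "subgraph_of D (add_edge T e)" for D
  proof -
    have "sedges D = sedges C"
      using tree_add_edge_cycle_edges_subset[OF T] C D by blast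
    moreover from this have "sverts D = sverts C"
      using C D by (simp add: cycle_verts subgraph_of_def)
    ultimately show ?thesis
      by (cases C, cases D) simp
  qed
  with C have "\<exists>!C. cycle_graph C \<and> subgraph_of C (add_edge T e)"
    by blast
  from theI'[OF this] show "cycle_graph (fundamental_cycle T e)"
    and "subgraph_of (fundamental_cycle T e) (add_edge T e)"
    by (simp_all add: fundamental_cycle_def)
qed

section \<open>Spline rings as intersections over spanning subgraphs\<close>

text \<open>Each spline condition concerns a single edge. The family must be nonempty because an
  empty intersection is the whole type, not the carrier.\<close>

lemma splines_cong_edges:
  assumes "\<And>H. H \<in> \<H> \<Longrightarrow> sverts H = sverts G" "\<H> \<noteq> {}"
    and "sedges G = (\<Union>H\<in>\<H>. sedges H)"
  shows "splines R G \<alpha> = (\<Inter>H\<in>\<H>. splines R H \<alpha>)"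
proof -
  have "carrier (power_ring R (sverts H)) = carrier (power_ring R (sverts G))" if "H \<in> \<H>" for H
    using assms(1)[OF that] by simp
  then show ?thesis
    using assms(2) unfolding splines_def assms(3) by blast
qed

theorem corollary6p4:
  fixes R :: "('a, 'b) ring_scheme"
    and G T :: "'v sgraph"
    and \<alpha> :: "'v set \<Rightarrow> 'a set"
    and n :: nat
  assumes "cring R"
    and "simple_graph G" and "card (sverts G) = n"
    and "edge_labeling R G \<alpha>"
    and "spanning_tree_of T G"
  shows "splines R G \<alpha> =
    splines R T \<alpha> \<inter> (\<Inter>e\<in>sedges G - sedges T. splines R (spanning_cycle G T e) \<alpha>)"
proof -
  have T: "tree_graph T" "sverts T = sverts G" "sedges T \<subseteq> sedges G"
    using assms(5) by (auto simp: spanning_tree_of_def subgraph_of_def)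
  \<comment> \<open>Including \<open>T\<close> covers the tree edges and keeps the family nonempty
    even when \<open>G\<close> has no other edges.\<close>
  define \<H> where "\<H> = insert T (spanning_cycle G T ` (sedges G - sedges T))"
  \<comment> \<open>The first fact covers the edges outside \<open>T\<close>; the second keeps the
    union of the edge sets within \<open>G\<close>.\<close>
  have C: "e \<in> sedges (spanning_cycle G T e)" "sedges (spanning_cycle G T e) \<subseteq> sedges G"
    if "e \<in> sedges G - sedges T" for e
  proof -
    have e: "e \<subseteq> sverts T" "card e = 2" "e \<notin> sedges T"
      using that assms(2) T(2) by (auto simp: simple_graph_def)
    note F = fundamental_cycle[OF T(1) e]
    show "e \<in> sedges (spanning_cycle G T e)"
      using tree_add_edge_cycle_contains[OF T(1) F] by (simp add: spanning_cycle_def)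
    show "sedges (spanning_cycle G T e) \<subseteq> sedges G"
      using F(2) that T(3) by (auto simp: spanning_cycle_def subgraph_of_def add_edge_def)
  qed
  have "\<H> \<noteq> {}"
    by (simp add: \<H>_def)
  moreover have "sedges G = (\<Union>H\<in>\<H>. sedges H)"
    using C T(3) by (auto simp: \<H>_def)
  moreover have "\<forall>H\<in>\<H>. sverts H = sverts G"
    using T(2) by (simp add: \<H>_def spanning_cycle_def)
  ultimately have "splines R G \<alpha> = (\<Inter>H\<in>\<H>. splines R H \<alpha>)"
    by (intro splines_cong_edges) blast+
  then show ?thesis
    by (simp add: \<H>_def)
qed

end
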